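(* Let $\mathcal{D}\subseteq\mathbb{R}^d$ be a compact convex set and $f:\mathcal{D}\to\mathbb{R}$ a convex differentiable function with minimizer $b^*$ and curvature constant $C_f$. Fix $\delta>0$. Consider the iteration: $b^{(0)}\in\mathcal{D}$, and for $k\ge0$, $\gamma_k=\frac{1}{k+1}$, $\hat d^{(k+1)}\in\mathcal{D}$ any point satisfying $\langle \hat d^{(k+1)},\nabla f(b^{(k)})\rangle\le \min_{s\in\mathcal{D}}\langle s,\nabla f(b^{(k)})\rangle+\frac{\delta C_f}{k+2}$, and $b^{(k+1)}=(1-\gamma_k)b^{(k)}+\gamma_k\hat d^{(k+1)}$. Then $$f(b^{(k)})-f(b^* )\le\frac{2C_f(1+\delta)H_{k+1}}{k+1},$$ where $H_n=\sum_{i=1}^n 1/i$ is the $n$-th harmonic number.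
   Context: The curvature constant is $C_f=\sup_{x,s\in\mathcal{D},\,\gamma\in[0,1],\,y=x+\gamma(s-x)}\frac{2}{\gamma^2}\big(f(y)-f(x)-\langle y-x,\nabla f(x)\rangle\big)$.
   Formalization: The bound is stated for k ≥ 1 only; at k = 0 it fails, e.g. for D = [0,1], f(x) = x, b^(0) = 1, where C_f = 0 but f(b^(0)) − f(b* ) = 1. *)

theory Defs
  imports "HOL-Analysis.Analysis"
begin

text \<open>
  The function is only meaningful on \<open>D\<close>, so differentiability is taken within \<open>D\<close>. If \<open>D\<close> is not
  full-dimensional, the gradient field \<open>g\<close> is not unique, but the inner products of \<open>g x\<close> with
  differences of points of a convex \<open>D\<close> do not depend on the choice.
\<close>

definition gradient_on ::
  "(real ^ 'n) set \<Rightarrow> (real ^ 'n \<Rightarrow> real) \<Rightarrow> (real ^ 'n \<Rightarrow> real ^ 'n) \<Rightarrow> bool" where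
  "gradient_on D f g \<longleftrightarrow> (\<forall>x\<in>D. (f has_derivative (\<lambda>h. h \<bullet> g x)) (at x within D))"

text \<open>
  The supremum is taken in the extended reals since it may be infinite. For \<open>\<gamma> = 0\<close> the expression
  evaluates to \<open>0\<close>, a value also attained at \<open>s = x\<close>, \<open>\<gamma> = 1\<close>, so that including
  \<open>\<gamma> = 0\<close> does not affect the supremum.
\<close>

definition curvature_constant ::
  "(real ^ 'n) set \<Rightarrow> (real ^ 'n \<Rightarrow> real) \<Rightarrow> (real ^ 'n \<Rightarrow> real ^ 'n) \<Rightarrow> ereal" where
  "curvature_constant D f g =
     (SUP (x, s, \<gamma>) \<in> D \<times> D \<times> {0..1}.
        let y = x + \<gamma> *\<^sub>R (s - x)
        in ereal (2 / \<gamma>\<^sup>2 * (f y - f x - (y - x) \<bullet> g x)))"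

end

theory Submission
  imports Defs
begin

text \<open>
  Let \<open>h j = f (b j) - f bstar\<close>. The curvature bound along the step, the approximate minimality of
  \<open>d (j + 1)\<close> and the tangent inequality at \<open>b j\<close> give
  \<open>(j + 1) h (j + 1) \<le> j h j + C (\<delta> / (j + 2) + 1 / (2 (j + 1)))\<close>. The last term is at most
  \<open>C (1 + \<delta>) / (j + 2)\<close>, so the sum telescopes to \<open>k h k \<le> C (1 + \<delta>) H\<^bsub>k + 1\<^esub>\<close>, and
  \<open>1 / k \<le> 2 / (k + 1)\<close>. If \<open>C\<close> is infinite, the bound is trivial.
\<close>

text \<open>Convexity bounds the difference quotients along the segment from \<open>x\<close> to
  \<open>y\<close> by \<open>f y - f x\<close>, and their limit at \<open>0\<close> is
  \<open>f' (y - x)\<close>. The segment stays in \<open>D\<close>, so \<open>x\<close> may be a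
  boundary point and \<open>D\<close> may have empty interior.\<close>

lemma convex_on_above_tangent_within:
  fixes f :: "'a::real_normed_vector \<Rightarrow> real"
  assumes conv: "convex_on D f" and deriv: "(f has_derivative f') (at x within D)"
    and x: "x \<in> D" and y: "y \<in> D"
  shows "f x + f' (y - x) \<le> f y"
proof -
  define p where "p t = x + t *\<^sub>R (y - x)" for t :: real
  have p_eq: "p t = (1 - t) *\<^sub>R x + t *\<^sub>R y" for t
    by (simp add: p_def algebra_simps)
  have p_in: "p ` {0..1} \<subseteq> D"
    using convex_on_imp_convex[OF conv] x y by (auto simp: p_eq intro!: convexD)
  have "(p has_derivative (\<lambda>t. t *\<^sub>R (y - x))) (at 0 within {0..1})"
    unfolding p_def by (auto intro!: derivative_eq_intros)
  moreover have "(f has_derivative f') (at (p 0) within p ` {0..1})"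
    using has_derivative_subset[OF deriv p_in] by (simp add: p_def)
  ultimately have "((\<lambda>t. f (p t)) has_derivative (\<lambda>t. f' (t *\<^sub>R (y - x)))) (at 0 within {0..1})"
    by (rule has_derivative_in_compose)
  moreover have "(\<lambda>t. f' (t *\<^sub>R (y - x))) = (*) (f' (y - x))"
    using has_derivative_linear[OF deriv] by (auto simp: linear_scale mult.commute)
  ultimately have "((\<lambda>t. f (p t)) has_field_derivative f' (y - x)) (at 0 within {0..1})"
    by (simp add: has_field_derivative_def)
  then have lim: "((\<lambda>t. (f (p t) - f x) / t) \<longlongrightarrow> f' (y - x)) (at 0 within {0..1})"
    by (simp add: has_field_derivative_iff p_def)
  have "(f (p t) - f x) / t \<le> f y - f x" if "t \<in> {0..1}" "t \<noteq> 0" for t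
  proof -
    have "f (p t) \<le> (1 - t) * f x + t * f y"
      unfolding p_eq using convex_onD[OF conv, of t x y] that x y by auto
    then show ?thesis
      using that by (simp add: field_simps)
  qed
  then have "\<forall>\<^sub>F t in at 0 within {0..1}. (f (p t) - f x) / t \<le> f y - f x"
    by (auto simp: eventually_at_filter)
  moreover have "at (0::real) within {0..1} \<noteq> bot"
    by (simp add: at_within_Icc_at_right)
  ultimately show ?thesis
    using tendsto_upperbound[OF lim] by force
qed

lemma curvature_constant_upper:
  assumes "x \<in> D" "s \<in> D" "t \<in> {0..1}"
  shows "ereal (2 / t\<^sup>2 * (f (x + t *\<^sub>R (s - x)) - f x - (t *\<^sub>R (s - x)) \<bullet> g x))
    \<le> curvature_constant D f g"
  unfolding curvature_constant_def
  by (rule SUP_upper2[of "(x, s, t)"]) (use assms in \<open>auto simp: Let_def\<close>)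

text \<open>The choice \<open>s = x\<close>, \<open>t = 1\<close> contributes the value
  \<open>0\<close> to the supremum.\<close>

lemma curvature_constant_nonneg:
  assumes "x \<in> D"
  shows "0 \<le> curvature_constant D f g"
  using curvature_constant_upper[of x D x 1 f g] assms by (simp add: zero_ereal_def)

lemma curvature_constant_bound:
  assumes C: "curvature_constant D f g = ereal c"
    and "x \<in> D" "s \<in> D" "t \<in> {0..1}"
  shows "f (x + t *\<^sub>R (s - x)) \<le> f x + t * ((s - x) \<bullet> g x) + t\<^sup>2 / 2 * c"
\<comment> \<open>At \<open>t = 0\<close> division by zero makes the quotient \<open>0\<close>,
  which carries no information, but there both sides of the claim equal \<open>f x\<close>.\<close>
proof (cases "t = 0")
  case False
  have "2 / t\<^sup>2 * (f (x + t *\<^sub>R (s - x)) - f x - (t *\<^sub>R (s - x)) \<bullet> g x) \<le> c"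
    using curvature_constant_upper[of x D s t f g] assms by simp
  with False show ?thesis
    by (simp add: field_simps inner_diff_left)
qed auto

lemma weighted_recurrence_harm_bound:
  fixes h :: "nat \<Rightarrow> real"
  assumes c: "0 \<le> c"
    and step: "\<And>j. (real j + 1) * h (j + 1)
      \<le> real j * h j + c * (\<delta> / (real j + 2) + 1 / (2 * (real j + 1)))"
    and \<delta>: "0 \<le> \<delta>"
  shows "real k * h k \<le> c * (1 + \<delta>) * harm (k + 1)"
proof (induction k)
  \<comment> \<open>The weight \<open>real 0\<close> removes \<open>h 0\<close>, so the size of the
    initial gap does not enter the bound.\<close>
  case 0
  then show ?case using c \<delta> by (simp add: harm_nonneg)
next
  case (Suc k)
  \<comment> \<open>The denominator \<open>k + 2\<close> matches the increment from
    \<open>harm (k + 1)\<close> to \<open>harm (k + 2)\<close>.\<close>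
  have "1 / (2 * (real k + 1)) \<le> 1 / (real k + 2)"
    by (simp add: field_simps)
  then have "c * (\<delta> / (real k + 2) + 1 / (2 * (real k + 1))) \<le> c * ((1 + \<delta>) / (real k + 2))"
    using c by (intro mult_left_mono) (simp_all add: add_divide_distrib)
  moreover have "c * (1 + \<delta>) * harm (Suc k + 1)
    = c * (1 + \<delta>) * harm (k + 1) + c * ((1 + \<delta>) / (real k + 2))"
    by (simp add: harm_Suc field_simps)
  ultimately show ?case
    using step[of k] Suc by (simp add: add.commute)
qed

theorem theorem4:
  fixes D :: "(real ^ 'n) set"
    and f :: "real ^ 'n \<Rightarrow> real"
    and g :: "real ^ 'n \<Rightarrow> real ^ 'n"
    and bstar :: "real ^ 'n"
    and C :: ereal
    and \<delta> :: real
    and \<gamma> :: "nat \<Rightarrow> real"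
    and b d :: "nat \<Rightarrow> real ^ 'n"
    and k :: nat
  assumes "compact D" and "convex D"
    and "convex_on D f"
    and "gradient_on D f g"
    and "is_arg_min f (\<lambda>x. x \<in> D) bstar"
    and "C = curvature_constant D f g"
    and "\<delta> > 0"
    and "b 0 \<in> D"
    and "\<And>j. \<gamma> j = 1 / (real j + 1)"
    and "\<And>j. d (j + 1) \<in> D"
    and "\<And>j. ereal (d (j + 1) \<bullet> g (b j))
               \<le> ereal (INF s\<in>D. s \<bullet> g (b j)) + ereal \<delta> * C / ereal (real j + 2)"
    and "\<And>j. b (j + 1) = (1 - \<gamma> j) *\<^sub>R b j + \<gamma> j *\<^sub>R d (j + 1)"
    and "k \<ge> 1"
  shows "ereal (f (b k) - f bstar)
           \<le> 2 * C * ereal (1 + \<delta>) * ereal (harm (k + 1)) / ereal (real k + 1)"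
proof -
  have bstar: "bstar \<in> D" "\<And>x. x \<in> D \<Longrightarrow> f bstar \<le> f x"
    using assms(5) by (auto simp: is_arg_min_linorder)
  have C_nonneg: "0 \<le> C"
    using curvature_constant_nonneg[OF bstar(1)] assms(6) by simp
  have \<gamma>01: "\<gamma> j \<in> {0..1}" for j
    by (simp add: assms(9))
  have b_eq: "b (j + 1) = b j + \<gamma> j *\<^sub>R (d (j + 1) - b j)" for j
    unfolding assms(12) by (simp add: algebra_simps)
  have b_in: "b j \<in> D" for j
  proof (induction j)
    case (Suc j)
    have "(1 - \<gamma> j) *\<^sub>R b j + \<gamma> j *\<^sub>R d (j + 1) \<in> D"
      using Suc assms(2,10) \<gamma>01[of j] by (intro convexD) auto
    then show ?case using assms(12)[of j] by simp
  qed (rule assms(8))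
  \<comment> \<open>This serves the case of infinite \<open>C\<close>: since
    \<open>\<infinity> * 0 = 0\<close> in \<open>ereal\<close>, the harmonic factor must be nonzero
    for the bound to be infinite.\<close>
  have harm_nz: "harm (Suc k) \<noteq> (0 :: real)"
    by (rule less_imp_neq[symmetric], rule harm_pos) simp
  show ?thesis
  proof (cases C)
    case (real c)
    have c: "0 \<le> c" using C_nonneg real by simp
    define h where "h j = f (b j) - f bstar" for j
    have "(real j + 1) * h (j + 1)
      \<le> real j * h j + c * (\<delta> / (real j + 2) + 1 / (2 * (real j + 1)))" for j
    proof -
      \<comment> \<open>A real \<open>INF\<close> is a lower bound only if the set is bounded below;
        compactness of \<open>D\<close> ensures this.\<close>
      have "bdd_below ((\<lambda>s. s \<bullet> g (b j)) ` D)"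
        by (intro bounded_imp_bdd_below compact_imp_bounded compact_continuous_image
            continuous_intros assms(1))
      then have "(INF s\<in>D. s \<bullet> g (b j)) \<le> bstar \<bullet> g (b j)"
        using bstar(1) by (rule cINF_lower)
      moreover have "d (j + 1) \<bullet> g (b j) \<le> (INF s\<in>D. s \<bullet> g (b j)) + \<delta> * c / (real j + 2)"
        using assms(11)[of j] real by simp
      moreover have "f (b j) + (bstar - b j) \<bullet> g (b j) \<le> f bstar"
        using assms(4) b_in bstar(1)
        by (intro convex_on_above_tangent_within[OF assms(3)]) (auto simp: gradient_on_def)
      \<comment> \<open>Comparing \<open>d (j + 1)\<close> with \<open>bstar\<close> in the linear
        subproblem costs only the allowed error, and the tangent inequality bounds
        \<open>(bstar - b j) \<bullet> g (b j)\<close> by \<open>- h j\<close>.\<close>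
      ultimately have "(d (j + 1) - b j) \<bullet> g (b j) \<le> \<delta> * c / (real j + 2) - h j"
        by (simp add: h_def inner_diff_left)
      then have "\<gamma> j * ((d (j + 1) - b j) \<bullet> g (b j)) \<le> \<gamma> j * (\<delta> * c / (real j + 2) - h j)"
        using \<gamma>01[of j] by (intro mult_left_mono) auto
      moreover have "f (b (j + 1))
        \<le> f (b j) + \<gamma> j * ((d (j + 1) - b j) \<bullet> g (b j)) + (\<gamma> j)\<^sup>2 / 2 * c"
        unfolding b_eq using assms(6,10) real b_in \<gamma>01
        by (intro curvature_constant_bound) auto
      ultimately have "h (j + 1) \<le> h j + \<gamma> j * (\<delta> * c / (real j + 2) - h j) + (\<gamma> j)\<^sup>2 / 2 * c"
        by (simp add: h_def)
      \<comment> \<open>Multiplying by \<open>1 / \<gamma> j\<close> turns the factor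
        \<open>1 - \<gamma> j\<close> of \<open>h j\<close> into \<open>j\<close>, the weight that
        telescopes.\<close>
      then have "(real j + 1) * h (j + 1) \<le> (real j + 1) *
        (h j + \<gamma> j * (\<delta> * c / (real j + 2) - h j) + (\<gamma> j)\<^sup>2 / 2 * c)"
        by (intro mult_left_mono) auto
      also have "\<dots> = (real j + 1) * h j + ((real j + 1) * \<gamma> j) * (\<delta> * c / (real j + 2) - h j)
          + ((real j + 1) * \<gamma> j) * \<gamma> j / 2 * c"
        by (simp add: algebra_simps power2_eq_square)
      also have "(real j + 1) * \<gamma> j = 1"
        by (simp add: assms(9))
      also have "(real j + 1) * h j + 1 * (\<delta> * c / (real j + 2) - h j) + 1 * \<gamma> j / 2 * c
        = real j * h j + c * (\<delta> / (real j + 2) + 1 / (2 * (real j + 1)))"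
        unfolding assms(9) by (simp add: algebra_simps)
      finally show ?thesis .
    qed
    then have kh: "real k * h k \<le> c * (1 + \<delta>) * harm (k + 1)"
      using c assms(7) by (intro weighted_recurrence_harm_bound) auto
    have "0 \<le> h k"
      using bstar(2)[OF b_in] by (simp add: h_def)
    \<comment> \<open>The factor 2 of the theorem arises here, from \<open>k + 1 \<le> 2 * k\<close>
      for \<open>k \<ge> 1\<close>.\<close>
    then have "(real k + 1) * h k \<le> (2 * real k) * h k"
      using assms(13) by (intro mult_right_mono) auto
    with kh have "(real k + 1) * h k \<le> 2 * c * (1 + \<delta>) * harm (k + 1)"
      by linarith
    then have "h k \<le> 2 * c * (1 + \<delta>) * harm (k + 1) / (real k + 1)"
      by (simp add: pos_le_divide_eq mult.commute)
    moreover have "2 * C * ereal (1 + \<delta>) * ereal (harm (k + 1)) / ereal (real k + 1)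
      = ereal (2 * c * (1 + \<delta>) * harm (k + 1) / (real k + 1))"
      unfolding real by simp
    ultimately show ?thesis by (simp add: h_def)
  next
    case PInf
    with harm_nz assms(7) show ?thesis by simp
  next
    case MInf
    with C_nonneg show ?thesis by simp
  qed
qed

end
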